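(* Let $F \in \mathcal{H}_2$. Then $\varrho^{\epsilon}(F)$ converges to $\varrho(F)$ in the Hausdorff distance as $\epsilon \to 0$.
   Context: $\mathbb{T}^2=\mathbb{R}^2/\mathbb{Z}^2$, and $\mathcal{H}_2$ is the set of all lifts $F:\mathbb{R}^2\to\mathbb{R}^2$ of homeomorphisms $f:\mathbb{T}^2\to\mathbb{T}^2$ homotopic to the identity; equivalently, $F$ is a homeomorphism of $\mathbb{R}^2$ with $F(x+k)=F(x)+k$ for all $x\in\mathbb{R}^2$, $k\in\mathbb{Z}^2$. $\|\cdot\|$ is the Euclidean norm. Rotation set: $\varrho(F)$ is the set of all $v\in\mathbb{R}^2$ for which there exist integers $n_i\nearrow\infty$ and points $x_i\in\mathbb{R}^2$ with $\lim_{i\to\infty}\frac{F^{n_i}(x_i)-x_i}{n_i}=v$. Pseudo-orbits: for $\epsilon\ge 0$ and $n\in\mathbb{N}$, an $\epsilon$-pseudo-orbit of $F$ of length $n+1$ is a tuple $(\xi_j)_{j=0}^n$ of points of $\mathbb{R}^2$ with $\|F(\xi_j)-\xi_{j+1}\|\le\epsilon$ for all $j\in\{0,\ldots,n-1\}$ (non-strict inequality). $\epsilon$-rotation set: $\varrho^{\epsilon}(F)$ is the set of all accumulation points of sequences $\left(\frac{\xi^i_{n_i}-\xi^i_0}{n_i}\right)_{i\in\mathbb{N}}$, where $n_i\to\infty$ and $(\xi^i_j)_{j=0}^{n_i}$ is an $\epsilon$-pseudo-orbit of $F$ of length $n_i+1$ for each $i$. Equivalently, $\varrho^{\epsilon}(F)=\bigcap_{n\ge1}\overline{\bigcup_{k\ge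 n}K_k^{\epsilon}(F)}$, where $K_k^{\epsilon}(F)=\left\{\frac{\xi_k-\xi_0}{k} : (\xi_j)_{j=0}^k \text{ is an } \epsilon\text{-pseudo-orbit of } F \text{ with } \xi_0\in[0,1]^2\right\}$. *)

theory Defs
  imports "HOL-Analysis.Analysis"
begin

text \<open>Lifts to the plane of homeomorphisms of the torus homotopic to the identity,
  described as the homeomorphisms of the plane commuting with integer translations.\<close>

definition torus_lifts :: "(real^2 \<Rightarrow> real^2) set" where
  "torus_lifts = {F. (\<exists>G. homeomorphism UNIV UNIV F G) \<and>
     (\<forall>x k. (\<forall>i. k $ i \<in> \<int>) \<longrightarrow> F (x + k) = F x + k)}"

definition rotation_set :: "(real^2 \<Rightarrow> real^2) \<Rightarrow> (real^2) set" where
  "rotation_set F = {v. \<exists>(n :: nat \<Rightarrow> nat) (x :: nat \<Rightarrow> real^2).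
     mono n \<and> filterlim n at_top sequentially \<and>
     (\<lambda>i. ((F ^^ n i) (x i) - x i) /\<^sub>R real (n i)) \<longlonglongrightarrow> v}"

text \<open>A pseudo-orbit with \<open>n + 1\<close> points is represented by a sequence of which only
  the entries \<open>0, \<dots>, n\<close> matter.\<close>

definition pseudo_orbit ::
    "real \<Rightarrow> (real^2 \<Rightarrow> real^2) \<Rightarrow> nat \<Rightarrow> (nat \<Rightarrow> real^2) \<Rightarrow> bool" where
  "pseudo_orbit \<epsilon> F n \<xi> \<longleftrightarrow> (\<forall>j<n. norm (F (\<xi> j) - \<xi> (Suc j)) \<le> \<epsilon>)"

text \<open>Accumulation points of a sequence in the sense of subsequential limits; these need not be
  limit points of its range.\<close>

definition accumulation_points :: "(nat \<Rightarrow> 'a::metric_space) \<Rightarrow> 'a set" where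
  "accumulation_points X = {v. \<exists>r. strict_mono (r :: nat \<Rightarrow> nat) \<and> (X \<circ> r) \<longlonglongrightarrow> v}"

definition eps_rotation_set :: "real \<Rightarrow> (real^2 \<Rightarrow> real^2) \<Rightarrow> (real^2) set" where
  "eps_rotation_set \<epsilon> F = {v. \<exists>(n :: nat \<Rightarrow> nat) (\<xi> :: nat \<Rightarrow> nat \<Rightarrow> real^2).
     filterlim n at_top sequentially \<and> (\<forall>i. pseudo_orbit \<epsilon> F (n i) (\<xi> i)) \<and>
     v \<in> accumulation_points (\<lambda>i. (\<xi> i (n i) - \<xi> i 0) /\<^sub>R real (n i))}"

text \<open>Values are taken in the extended nonnegative reals, so that suprema and infima carry no
  conventions for empty or unbounded sets: the distance from a nonempty set to the empty set
  is infinite.\<close>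

definition hausdorff_distance :: "'a::metric_space set \<Rightarrow> 'a set \<Rightarrow> ennreal" where
  "hausdorff_distance A B =
     max (SUP a\<in>A. INF b\<in>B. ennreal (dist a b)) (SUP b\<in>B. INF a\<in>A. ennreal (dist a b))"

end

theory Submission
  imports Defs
begin

text \<open>A rotation vector is an \<open>\<epsilon>\<close>-rotation vector for every \<open>\<epsilon> \<ge> 0\<close>, because orbits are
  pseudo-orbits. The theorem is therefore about the other direction: for small \<open>\<epsilon>\<close> no
  \<open>\<epsilon>\<close>-rotation vector is far from the rotation set.

  Fix a length \<open>m\<close>. For small \<open>\<epsilon>\<close> a block of \<open>m\<close> steps of an \<open>\<epsilon>\<close>-pseudo-orbit stays close to \<open>m\<close>
  steps of an orbit. The average speed of a long pseudo-orbit is the mean over its blocks, so it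
  is close to the convex hull of the average speeds of orbits of length \<open>m\<close>
  (\<open>eps_rotation_set_near_hull\<close>). Since the blocks can follow unrelated orbits, nothing better
  than the convex hull can come out of this argument. A limit, for \<open>\<epsilon>\<close> tending to 0, of
  \<open>\<epsilon>\<close>-rotation vectors lies in the closures of these hulls for all \<open>m\<close>, and it remains to see
  that every such vector is a rotation vector (\<open>mem_rotation_setI\<close>).

  This holds in the plane because of an idea of Misiurewicz and Ziemian: the set of
  displacements \<open>G x - x\<close> of a lift \<open>G\<close> is convex up to an error that does not depend on \<open>G\<close>
  (\<open>hull_displacement_near\<close>). Applied to \<open>G = F ^^ m\<close> and divided by \<open>m\<close>, the error tends to 0.
  For the idea, let \<open>\<gamma>\<close> be the image under \<open>G\<close> of a segment in the half-open unit square, so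
  that \<open>\<gamma>\<close> is disjoint from all its nonzero integer translates. If \<open>\<gamma>\<close> avoided a disc of radius
  2 centred on the segment between its end points, a piece of \<open>\<gamma>\<close> would arch over half of this
  disc. Some integer translate of that piece would start within the half disc and reach higher
  than the arch, so that it would have to cross it (\<open>upper_arc_meets_translate\<close>).\<close>

section \<open>Planar paths and their translates\<close>

text \<open>This is where planarity enters. Suppose that no translate of the arc \<open>\<gamma>\<close> by an element of
  \<open>\<Lambda> - {0}\<close> meets \<open>\<gamma>\<close>. The arc spans the upper half of \<open>ball 0 2\<close> like an arch, and this half
  disc contains a disc of radius 1, so some translate \<open>k + \<gamma>\<close> starts inside the half disc, below
  the arch. Since \<open>k\<close> points upwards, the highest point of \<open>k + \<gamma>\<close> lies above the whole arch. So
  \<open>k + \<gamma>\<close> must leave the region below the arch, but it can cross neither the arch nor, being at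
  positive height, the axis. The crossing is produced by Fashoda's theorem in a box that has the
  axis as its bottom and the top of \<open>k + \<gamma>\<close> at its upper edge: \<open>\<gamma>\<close>, prolonged along the axis,
  joins the vertical sides; a segment from 0 followed by a piece of \<open>k + \<gamma>\<close> joins the horizontal
  sides.\<close>

lemma upper_arc_meets_translate:
  fixes \<gamma> :: "real \<Rightarrow> real^2"
  assumes path: "path \<gamma>"
    and start: "pathstart \<gamma> $ 2 = 0" "pathstart \<gamma> $ 1 < 0"
    and finish: "pathfinish \<gamma> $ 2 = 0" "pathfinish \<gamma> $ 1 > 0"
    and upper: "\<And>z. z \<in> path_image \<gamma> \<Longrightarrow> z $ 2 \<ge> 0"
    and ball: "path_image \<gamma> \<inter> ball 0 2 = {}"
    and net: "\<And>z. \<exists>k\<in>\<Lambda>. dist z k < 1"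
  shows "\<exists>k\<in>\<Lambda>. k \<noteq> 0 \<and> path_image \<gamma> \<inter> (+) k ` path_image \<gamma> \<noteq> {}"
proof (rule ccontr)
  assume "\<not> ?thesis"
  then have disj: "path_image \<gamma> \<inter> (+) k ` path_image \<gamma> = {}" if "k \<in> \<Lambda>" "k \<noteq> 0" for k
    using that by blast
  define c :: "real^2" where "c = axis 2 1"
  have c: "c $ 1 = 0" "c $ 2 = 1"
    by (auto simp: c_def axis_def)
  \<comment> \<open>The unit disc about \<open>c = (0, 1)\<close> lies in the upper half of \<open>ball 0 2\<close>.\<close>
  obtain k where k: "k \<in> \<Lambda>" "dist (c - pathstart \<gamma>) k < 1"
    using net by blast
  define p where "p = pathstart \<gamma> + k"
  have pc: "norm (p - c) < 1"
    using k(2) by (simp add: p_def dist_norm algebra_simps norm_minus_commute)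
  have p2: "p $ 2 > 0"
    using component_le_norm_cart[of "p - c" 2] pc c by auto
  then have k2: "k $ 2 > 0"
    using start by (simp add: p_def)
  have "norm p \<le> norm (p - c) + norm c"
    using norm_triangle_sub[of p c] by (simp add: add.commute)
  then have normp: "norm p < 2"
    using pc by (simp add: c_def)
  obtain t where t: "t \<in> {0..1}" "\<And>s. s \<in> {0..1} \<Longrightarrow> \<gamma> s $ 2 \<le> \<gamma> t $ 2"
  proof -
    have "continuous_on {0..1} (\<lambda>s. \<gamma> s $ 2)"
      using path unfolding path_def by (intro continuous_intros)
    then show ?thesis
      using continuous_attains_sup[of "{0..1::real}" "\<lambda>s. \<gamma> s $ 2"] that by auto
  qed
  have top: "z $ 2 \<le> \<gamma> t $ 2" if "z \<in> path_image \<gamma>" for z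
    using that t by (auto simp: path_image_def)
  have t2: "\<gamma> t $ 2 \<ge> 0"
    using upper t by (auto simp: path_image_def)
  obtain B where B: "\<And>z. z \<in> path_image \<gamma> \<Longrightarrow> norm z \<le> B" "B > 0"
    using bounded_path_image[OF path] by (auto simp: bounded_pos)
  define R where "R = B + norm k + 2"
  have R: "R > 0" using B by (simp add: R_def add_pos_nonneg)
  define lo hi :: "real^2" where "lo = vector [- R, 0]" and "hi = vector [R, \<gamma> t $ 2 + k $ 2]"
  have lohi: "lo $ 1 = - R" "lo $ 2 = 0" "hi $ 1 = R" "hi $ 2 = \<gamma> t $ 2 + k $ 2"
    by (auto simp: lo_def hi_def)
  have box: "z \<in> cbox lo hi \<longleftrightarrow> \<bar>z $ 1\<bar> \<le> R \<and> 0 \<le> z $ 2 \<and> z $ 2 \<le> \<gamma> t $ 2 + k $ 2" for z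
    by (auto simp: mem_box_cart forall_2 lohi)
  define r :: "real^2" where "r = vector [R, 0]"
  have r: "r $ 1 = R" "r $ 2 = 0"
    by (auto simp: r_def)
  have abs1: "\<bar>z $ 1\<bar> \<le> B" if "z \<in> path_image \<gamma>" for z
    using component_le_norm_cart[of z 1] B(1)[OF that] by linarith
  have Bs: "\<bar>pathstart \<gamma> $ 1\<bar> \<le> B" "\<bar>pathfinish \<gamma> $ 1\<bar> \<le> B"
    using abs1 by auto
  have RB: "B \<le> R" by (simp add: R_def)
  define f where "f = linepath lo (pathstart \<gamma>) +++ \<gamma> +++ linepath (pathfinish \<gamma>) r"
  define \<delta> where "\<delta> = (+) k \<circ> subpath 0 t \<gamma>"
  have \<delta>_sub: "path_image \<delta> \<subseteq> (+) k ` path_image \<gamma>"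
    unfolding \<delta>_def path_image_compose
    using path_image_subpath_subset[of 0 t \<gamma>] t(1) by auto
  have \<delta>_ends: "pathstart \<delta> = p" "pathfinish \<delta> = k + \<gamma> t"
    by (auto simp: \<delta>_def pathstart_compose pathfinish_compose p_def pathstart_def add.commute)
      (auto simp: subpath_def pathfinish_def)
  have \<delta>_path: "path \<delta>"
    unfolding \<delta>_def path_translation_eq using path t(1) by (auto intro: path_subpath)
  define g where "g = linepath 0 p +++ \<delta>"
  have pf: "path f" and pg: "path g"
    using path \<delta>_path \<delta>_ends by (auto simp: f_def g_def)
  have imf: "path_image f = closed_segment lo (pathstart \<gamma>) \<union> path_image \<gamma> \<union> closed_segment (pathfinish \<gamma>) r"
    by (simp add: f_def path_image_join Un_assoc)
  have img: "path_image g = closed_segment 0 p \<union> path_image \<delta>"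
    by (simp add: g_def path_image_join \<delta>_ends)
  have seg2: "z $ 2 = 0" if "z \<in> closed_segment u v" "u $ 2 = 0" "v $ 2 = 0" for u v z :: "real^2"
    using that by (auto simp: closed_segment_def)
  have seg1: "min (u$1) (v$1) \<le> z $ 1 \<and> z $ 1 \<le> max (u$1) (v$1)" if "z \<in> closed_segment u v" for u v z :: "real^2"
  proof -
    have "z $ 1 \<in> closed_segment (u$1) (v$1)"
      using that by (auto simp: closed_segment_def)
    then show ?thesis by (auto simp: closed_segment_eq_real_ivl split: if_splits)
  qed
  have seg0: "\<exists>u. 0 \<le> u \<and> u \<le> 1 \<and> z = u *\<^sub>R p" if "z \<in> closed_segment 0 p" for z
    using that by (auto simp: closed_segment_def)
  have ptop: "p $ 2 \<le> \<gamma> t $ 2 + k $ 2"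
    using start t2 by (simp add: p_def)
  have f_box: "path_image f \<subseteq> cbox lo hi"
  proof
    fix z assume "z \<in> path_image f"
    then consider "z \<in> closed_segment lo (pathstart \<gamma>)" | "z \<in> path_image \<gamma>" | "z \<in> closed_segment (pathfinish \<gamma>) r"
      unfolding imf by auto
    then show "z \<in> cbox lo hi"
    proof cases
      case 1
      then have "z $ 2 = 0" using seg2 lohi r start by blast
      with seg1[OF 1] show ?thesis using Bs RB R lohi r t2 k2 by (auto simp: box min_def max_def split: if_splits)
    next
      case 2
      then show ?thesis using abs1[OF 2] upper[OF 2] top[OF 2] RB k2 by (auto simp: box)
    next
      case 3
      then have "z $ 2 = 0" using seg2 lohi r finish by blast
      with seg1[OF 3] show ?thesis using Bs RB R lohi r t2 k2 by (auto simp: box min_def max_def split: if_splits)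
    qed
  qed
  have g_box: "path_image g \<subseteq> cbox lo hi"
  proof
    fix z assume "z \<in> path_image g"
    then consider "z \<in> closed_segment 0 p" | "z \<in> path_image \<delta>"
      unfolding img by auto
    then show "z \<in> cbox lo hi"
    proof cases
      case 1
      then obtain u where u: "0 \<le> u" "u \<le> 1" "z = u *\<^sub>R p" using seg0 by blast
      have "norm z \<le> norm p" using u by (simp add: mult_left_le_one_le)
      then have "\<bar>z $ 1\<bar> \<le> R"
        using component_le_norm_cart[of z 1] normp B by (simp add: R_def) (smt (verit) norm_ge_zero)
      moreover have "z $ 2 \<le> p $ 2" "0 \<le> z $ 2" using u p2 by (auto simp: mult_left_le_one_le)
      ultimately show ?thesis using ptop by (auto simp: box)
    next
      case 2
      then obtain y where y: "y \<in> path_image \<gamma>" "z = k + y" using \<delta>_sub by auto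
      have "\<bar>z $ 1\<bar> \<le> R"
        using abs1[OF y(1)] component_le_norm_cart[of k 1] y(2) by (simp add: R_def)
      then show ?thesis using upper[OF y(1)] top[OF y(1)] k2 y(2) by (auto simp: box)
    qed
  qed
  have ends: "pathstart f $ 1 = lo $ 1" "pathfinish f $ 1 = hi $ 1"
     "pathstart g $ 2 = lo $ 2" "pathfinish g $ 2 = hi $ 2"
    by (simp_all add: f_def g_def lohi lohi r \<delta>_ends)
  from fashoda[OF pf pg f_box g_box ends]
  obtain z where z: "z \<in> path_image f" "z \<in> path_image g" .
  have \<delta>_pos: "z $ 2 > 0" if "z \<in> path_image \<delta>"
    using that \<delta>_sub upper k2 by fastforce
  \<comment> \<open>The intersection point is not on \<open>\<gamma>\<close>, so it is on the axis; there the vertical path has only the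
    point 0, which the horizontal path avoids.\<close>
  have gen: "z \<notin> path_image \<gamma>"
  proof
    assume zg: "z \<in> path_image \<gamma>"
    show False
    proof (cases "z \<in> path_image \<delta>")
      case True
      then show False using zg \<delta>_sub disj[OF k(1)] k2 by (metis disjoint_iff less_irrefl subsetD zero_index)
    next
      case False
      then have "z \<in> closed_segment 0 p" using z img by auto
      then obtain u where u: "0 \<le> u" "u \<le> 1" "z = u *\<^sub>R p" using seg0 by blast
      have "norm z \<le> norm p" using u by (simp add: mult_left_le_one_le)
      then show False using normp zg ball by auto
    qed
  qed
  have z2: "z $ 2 = 0"
    using z(1) gen seg2 lohi r start finish unfolding imf by blast
  have "z = 0"
  proof -
    have "z \<in> closed_segment 0 p" using z(2) img \<delta>_pos z2 by auto
    then obtain u where "z = u *\<^sub>R p" using seg0 by blast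
    then show ?thesis using z2 p2 by auto
  qed
  moreover have "z $ 1 < 0 \<or> z $ 1 > 0"
  proof -
    from z(1) gen consider "z \<in> closed_segment lo (pathstart \<gamma>)" | "z \<in> closed_segment (pathfinish \<gamma>) r"
      unfolding imf by auto
    then show ?thesis
      by cases (use seg1 start finish lohi r R in \<open>fastforce simp: min_def max_def split: if_splits\<close>)+
  qed
  ultimately show False by simp
qed

text \<open>Take the first time \<open>t1\<close> at which \<open>\<gamma>\<close> meets the nonnegative half of the axis, and the last
  time \<open>t0\<close> before it on the nonpositive half. In between \<open>\<gamma>\<close> is off the axis, hence on one side
  of it.\<close>

lemma path_has_arc_off_axis:
  fixes \<gamma> :: "real \<Rightarrow> real^2"
  assumes path: "path \<gamma>"
    and start: "pathstart \<gamma> $ 2 = 0" "pathstart \<gamma> $ 1 < 0"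
    and finish: "pathfinish \<gamma> $ 2 = 0" "pathfinish \<gamma> $ 1 > 0"
    and nz: "0 \<notin> path_image \<gamma>"
  obtains \<alpha> where "path \<alpha>" "path_image \<alpha> \<subseteq> path_image \<gamma>"
    "pathstart \<alpha> $ 2 = 0" "pathstart \<alpha> $ 1 < 0" "pathfinish \<alpha> $ 2 = 0" "pathfinish \<alpha> $ 1 > 0"
    "(\<forall>z\<in>path_image \<alpha>. z $ 2 \<ge> 0) \<or> (\<forall>z\<in>path_image \<alpha>. z $ 2 \<le> 0)"
proof -
  have cont: "continuous_on {0..1} \<gamma>" using path by (simp add: path_def)
  have cl: "closed ({0..1} \<inter> \<gamma> -` {z. z $ 2 = 0 \<and> z $ 1 \<ge> 0})"
    "closed ({0..1} \<inter> \<gamma> -` {z. z $ 2 = 0 \<and> z $ 1 \<le> 0})"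
    by (intro continuous_closed_preimage cont closed_Collect_conj closed_Collect_eq closed_Collect_le continuous_intros; simp)+
  define P where "P = {0..1} \<inter> \<gamma> -` {z. z $ 2 = 0 \<and> z $ 1 \<ge> 0}"
  have "compact P" unfolding P_def
    using cl(1) by (metis (no_types) compact_Int_closed compact_Icc inf.left_idem)
  moreover have "1 \<in> P" using finish by (auto simp: P_def pathfinish_def)
  ultimately obtain t1 where t1: "t1 \<in> P" "\<And>s. s \<in> P \<Longrightarrow> t1 \<le> s"
    using compact_attains_inf[of P] by blast
  define Q where "Q = {0..t1} \<inter> ({0..1} \<inter> \<gamma> -` {z. z $ 2 = 0 \<and> z $ 1 \<le> 0})"
  have "compact Q" unfolding Q_def using cl(2) by (intro compact_Int_closed) auto
  moreover have "0 \<in> Q" using start t1 by (auto simp: Q_def P_def pathstart_def)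
  ultimately obtain t0 where t0: "t0 \<in> Q" "\<And>s. s \<in> Q \<Longrightarrow> s \<le> t0"
    using compact_attains_sup[of Q] by blast
  have t01: "0 \<le> t0" "t0 \<le> t1" "t1 \<le> 1" using t0(1) t1(1) by (auto simp: P_def Q_def)
  have nz': "\<gamma> s \<noteq> 0" if "s \<in> {0..1}" for s
    using nz that by (auto simp: path_image_def)
  have e: "\<gamma> t0 $ 2 = 0" "\<gamma> t0 $ 1 < 0" "\<gamma> t1 $ 2 = 0" "\<gamma> t1 $ 1 > 0"
    using t0(1) t1(1) nz'[of t0] nz'[of t1]
    by (auto simp: P_def Q_def vec_eq_iff forall_2 less_le)
  have off: "\<gamma> s $ 2 \<noteq> 0" if "t0 < s" "s < t1" for s
  proof
    assume s: "\<gamma> s $ 2 = 0"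
    show False
    proof (cases "\<gamma> s $ 1 \<ge> 0")
      case True
      then have "s \<in> P" using s that t01 by (auto simp: P_def)
      then show False using t1(2) that by force
    next
      case False
      then have "s \<in> Q" using s that t01 by (auto simp: Q_def)
      then show False using t0(2) that by force
    qed
  qed
  have "t0 < t1" using t01 e by (metis less_le order.asym)
  have sign: "(\<forall>s\<in>{t0..t1}. \<gamma> s $ 2 \<ge> 0) \<or> (\<forall>s\<in>{t0..t1}. \<gamma> s $ 2 \<le> 0)"
  proof (rule ccontr)
    assume "\<not> ?thesis"
    then obtain s s' where s: "s \<in> {t0..t1}" "s' \<in> {t0..t1}" "\<gamma> s $ 2 < 0" "\<gamma> s' $ 2 > 0"
      by (auto simp: not_le)
    then have ss: "s \<in> {t0<..<t1}" "s' \<in> {t0<..<t1}" using e by (auto simp: less_le)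
    have "connected ((\<lambda>s. \<gamma> s $ 2) ` {t0<..<t1})"
      using cont t01 by (intro connected_continuous_image continuous_intros) (auto intro: continuous_on_subset)
    then have "0 \<in> (\<lambda>s. \<gamma> s $ 2) ` {t0<..<t1}"
      using ss s by (meson connectedD_interval imageI less_imp_le)
    then show False using off by auto
  qed
  show thesis
  proof (rule that[of "subpath t0 t1 \<gamma>"])
    show "path (subpath t0 t1 \<gamma>)" using path t01 by (intro path_subpath) auto
    show "path_image (subpath t0 t1 \<gamma>) \<subseteq> path_image \<gamma>"
      using t01 by (intro path_image_subpath_subset) auto
    show "(\<forall>z\<in>path_image (subpath t0 t1 \<gamma>). z $ 2 \<ge> 0) \<or> (\<forall>z\<in>path_image (subpath t0 t1 \<gamma>). z $ 2 \<le> 0)"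
      using sign t01 by (simp add: path_image_subpath)
  qed (use e in auto)
qed

text \<open>An arc below the axis is reflected to the upper half plane, together with \<open>\<Lambda>\<close>. As \<open>\<Lambda>\<close> is
  an arbitrary 1-net, nothing is lost by this, nor by the rotation in the next proof.\<close>

lemma path_across_disc_meets_translate:
  fixes \<gamma> :: "real \<Rightarrow> real^2"
  assumes path: "path \<gamma>"
    and start: "pathstart \<gamma> $ 2 = 0" "pathstart \<gamma> $ 1 < 0"
    and finish: "pathfinish \<gamma> $ 2 = 0" "pathfinish \<gamma> $ 1 > 0"
    and ball: "path_image \<gamma> \<inter> ball 0 2 = {}"
    and net: "\<And>z. \<exists>k\<in>\<Lambda>. dist z k < 1"
  shows "\<exists>k\<in>\<Lambda>. k \<noteq> 0 \<and> path_image \<gamma> \<inter> (+) k ` path_image \<gamma> \<noteq> {}"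
proof -
  have "0 \<notin> path_image \<gamma>" using ball by auto
  then obtain \<alpha> where \<alpha>: "path \<alpha>" "path_image \<alpha> \<subseteq> path_image \<gamma>"
    "pathstart \<alpha> $ 2 = 0" "pathstart \<alpha> $ 1 < 0" "pathfinish \<alpha> $ 2 = 0" "pathfinish \<alpha> $ 1 > 0"
    and side: "(\<forall>z\<in>path_image \<alpha>. z $ 2 \<ge> 0) \<or> (\<forall>z\<in>path_image \<alpha>. z $ 2 \<le> 0)"
    using path_has_arc_off_axis[OF path start finish] by metis
  have "\<exists>k\<in>\<Lambda>. k \<noteq> 0 \<and> path_image \<alpha> \<inter> (+) k ` path_image \<alpha> \<noteq> {}"
    using side
  proof
    assume "\<forall>z\<in>path_image \<alpha>. z $ 2 \<ge> 0"
    then show ?thesis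
      using upper_arc_meets_translate[OF \<alpha>(1,3-6) _ _ net] \<alpha>(2) ball by blast
  next
    assume lower: "\<forall>z\<in>path_image \<alpha>. z $ 2 \<le> 0"
    define S :: "real^2 \<Rightarrow> real^2" where "S z = vector [z $ 1, - z $ 2]" for z
    have S: "S z $ 1 = z $ 1" "S z $ 2 = - z $ 2" for z by (auto simp: S_def)
    have add: "S (x + y) = S x + S y" for x y by (simp add: vec_eq_iff forall_2 S)
    have diff: "S (x - y) = S x - S y" for x y by (simp add: vec_eq_iff forall_2 S)
    have SS: "S (S z) = z" for z by (simp add: vec_eq_iff forall_2 S)
    have S0: "S z = 0 \<longleftrightarrow> z = 0" for z by (simp add: vec_eq_iff forall_2 S)
    have nS: "norm (S z) = norm z" for z by (simp add: norm_vec_def L2_set_def sum_2 S)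
    have lin: "linear S" by (rule linearI) (auto simp: add vec_eq_iff forall_2 S)
    have "\<exists>k\<in>S ` \<Lambda>. k \<noteq> 0 \<and> path_image (S \<circ> \<alpha>) \<inter> (+) k ` path_image (S \<circ> \<alpha>) \<noteq> {}"
    proof (rule upper_arc_meets_translate)
      show "path (S \<circ> \<alpha>)" using \<alpha>(1) lin
        by (intro path_continuous_image) (auto intro: linear_continuous_on linear_conv_bounded_linear[THEN iffD1])
      show "path_image (S \<circ> \<alpha>) \<inter> ball 0 2 = {}"
        using \<alpha>(2) ball by (auto simp: path_image_compose nS disjoint_iff)
      show "\<exists>k\<in>S ` \<Lambda>. dist z k < 1" for z
        using net[of "S z"] by (metis SS diff dist_norm image_eqI nS)
      show "z $ 2 \<ge> 0" if "z \<in> path_image (S \<circ> \<alpha>)" for z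
        using that lower by (auto simp: path_image_compose S)
    qed (use \<alpha> in \<open>auto simp: pathstart_compose pathfinish_compose S\<close>)
    then obtain k x y where "k \<in> \<Lambda>" "S k \<noteq> 0" "x \<in> path_image \<alpha>" "y \<in> path_image \<alpha>" "S x = S k + S y"
      by (auto simp: path_image_compose)
    then have "x = k + y" "k \<noteq> 0" by (metis SS add, metis S0)
    with \<open>k \<in> \<Lambda>\<close> \<open>x \<in> _\<close> \<open>y \<in> _\<close> show ?thesis by blast
  qed
  then show ?thesis using \<alpha>(2) by blast
qed

text \<open>If \<open>z\<close> were at distance 2 or more from the path, a rigid motion taking \<open>z\<close> to 0 and the
  segment to the first axis would lead to the situation of the previous lemma. The case of
  interest is the image of a short segment under a homeomorphism commuting with \<open>\<Lambda>\<close>: however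
  long and tangled this image is, it cannot keep away from any point of the segment between its
  end points.\<close>

lemma segment_near_path_disjoint_from_translates:
  fixes \<gamma> :: "real \<Rightarrow> real^2"
  assumes path: "path \<gamma>"
    and net: "\<And>z. \<exists>k\<in>\<Lambda>. dist z k < 1"
    and disj: "\<And>k. k \<in> \<Lambda> \<Longrightarrow> k \<noteq> 0 \<Longrightarrow> path_image \<gamma> \<inter> (+) k ` path_image \<gamma> = {}"
    and z: "z \<in> closed_segment (pathstart \<gamma>) (pathfinish \<gamma>)"
  shows "\<exists>w\<in>path_image \<gamma>. dist w z < 2"
proof (rule ccontr)
  assume "\<not> ?thesis"
  then have far: "2 \<le> norm (w - z)" if "w \<in> path_image \<gamma>" for w
    using that by (force simp: dist_norm not_less)
  obtain u where u: "0 \<le> u" "u \<le> 1" "z = (1 - u) *\<^sub>R pathstart \<gamma> + u *\<^sub>R pathfinish \<gamma>"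
    using z by (auto simp: closed_segment_def)
  define d where "d = pathfinish \<gamma> - pathstart \<gamma>"
  have s: "pathstart \<gamma> - z = (- u) *\<^sub>R d" and f: "pathfinish \<gamma> - z = (1 - u) *\<^sub>R d"
    by (simp_all add: u(3) d_def algebra_simps)
  have "norm (pathstart \<gamma> - z) > 0" "norm (pathfinish \<gamma> - z) > 0"
    using far[of "pathstart \<gamma>"] far[of "pathfinish \<gamma>"] by force+
  then have uu: "0 < u" "u < 1" and d: "norm d > 0"
    unfolding s f using u by (auto simp: less_le)
  have "norm d = norm (norm d *\<^sub>R axis 1 (1::real) :: real^2)"
    by simp
  then obtain T :: "real^2 \<Rightarrow> real^2"
    where T: "orthogonal_transformation T" "T d = norm d *\<^sub>R axis 1 1"
    by (rule orthogonal_transformation_exists)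
  have lin: "linear T" using T by (simp add: orthogonal_transformation_def)
  have nT: "norm (T x) = norm x" for x using T by (simp add: orthogonal_transformation)
  obtain T' where T': "\<And>x. T (T' x) = x" 
    using orthogonal_transformation_surj[OF T(1)] by (metis surjD)
  define \<beta> where "\<beta> = (\<lambda>x. T (x - z)) \<circ> \<gamma>"
  have "\<exists>k\<in>T ` \<Lambda>. k \<noteq> 0 \<and> path_image \<beta> \<inter> (+) k ` path_image \<beta> \<noteq> {}"
  proof (rule path_across_disc_meets_translate)
    show "path \<beta>" unfolding \<beta>_def using path lin
      by (intro path_continuous_image linear_continuous_on_compose[of _ "\<lambda>x. x - z" T] continuous_intros)
    show "path_image \<beta> \<inter> ball 0 2 = {}"
      using far by (force simp: \<beta>_def path_image_compose nT)
    show "\<exists>k\<in>T ` \<Lambda>. dist w k < 1" for w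
    proof -
      obtain k where k: "k \<in> \<Lambda>" "dist (T' w) k < 1" using net by blast
      have "w - T k = T (T' w - k)" by (simp add: T' linear_diff[OF lin])
      then have "dist w (T k) < 1" using k(2) by (simp add: dist_norm nT)
      then show ?thesis using k(1) by blast
    qed
  qed (use uu d T in \<open>auto simp: \<beta>_def pathstart_compose pathfinish_compose s f linear_scale[OF lin] axis_def linear_neg[OF lin]\<close>)
  then obtain k x y where k: "k \<in> \<Lambda>" "T k \<noteq> 0" "x \<in> path_image \<gamma>" "y \<in> path_image \<gamma>"
      "T (x - z) = T k + T (y - z)"
    by (auto simp: \<beta>_def path_image_compose)
  then have "T (x - z) = T (k + y - z)" by (simp add: linear_diff[OF lin] linear_add[OF lin])
  then have "T (x - (k + y)) = 0" by (simp add: linear_diff[OF lin] linear_add[OF lin])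
  then have "norm (x - (k + y)) = 0" by (metis nT norm_zero)
  then have "x = k + y" by simp
  moreover have "k \<noteq> 0" using k(2) linear_0[OF lin] by blast
  ultimately show False using disj[OF k(1)] k(3,4) by blast
qed

section \<open>Lifts of torus homeomorphisms and their displacements\<close>

lemma torus_lifts_continuous: "F \<in> torus_lifts \<Longrightarrow> continuous_on S F"
  by (auto simp: torus_lifts_def homeomorphism_def intro: continuous_on_subset)

lemma torus_lifts_inj: "F \<in> torus_lifts \<Longrightarrow> inj F"
  by (auto simp: torus_lifts_def homeomorphism_def inj_def) metis

lemma torus_lifts_add:
  "F \<in> torus_lifts \<Longrightarrow> (\<And>i. k $ i \<in> \<int>) \<Longrightarrow> F (x + k) = F x + k"
  by (auto simp: torus_lifts_def)

lemma torus_lifts_funpow: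
  assumes F: "F \<in> torus_lifts"
  shows "F ^^ n \<in> torus_lifts"
proof (induction n)
  case 0
  then show ?case
    by (auto simp: torus_lifts_def intro!: exI[of _ id] homeomorphismI continuous_intros)
next
  case (Suc n)
  obtain G H where "homeomorphism UNIV UNIV F G" "homeomorphism UNIV UNIV (F ^^ n) H"
    using F Suc.IH by (auto simp: torus_lifts_def)
  then have "homeomorphism UNIV UNIV (F \<circ> F ^^ n) (H \<circ> G)"
    using homeomorphism_compose by blast
  then have "\<exists>G. homeomorphism UNIV UNIV (F ^^ Suc n) G"
    by auto
  moreover have "(F ^^ Suc n) (x + k) = (F ^^ Suc n) x + k" if "\<forall>i. k $ i \<in> \<int>" for x k
    using that F Suc.IH by (simp add: torus_lifts_def)
  ultimately show ?case
    by (simp only: torus_lifts_def mem_Collect_eq) blast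
qed

lemma translate_into_unit_square:
  fixes x :: "real^'n"
  obtains k y where "\<And>i. k $ i \<in> \<int>" "\<And>i. 0 \<le> y $ i" "\<And>i. y $ i < 1" "x = y + k"
proof
  show "x = (\<chi> i. frac (x $ i)) + (\<chi> i. of_int \<lfloor>x $ i\<rfloor>)"
    by (simp add: vec_eq_iff frac_def)
qed (auto simp: frac_lt_1)

lemma norm_unit_square_le:
  fixes z :: "real^2"
  assumes "\<And>i. 0 \<le> z $ i" "\<And>i. z $ i < 1"
  shows "norm z \<le> 2"
  using norm_le_l1_cart[of z] assms[of 1] assms[of 2] by (simp add: sum_2)

lemma integer_vector_near:
  fixes z :: "real^2"
  shows "\<exists>k\<in>{k. \<forall>i. k $ i \<in> \<int>}. dist z k < 1"
proof
  let ?k = "(\<chi> i. of_int (round (z $ i))) :: real^2"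
  have le: "\<bar>z $ i - ?k $ i\<bar> \<le> 1 / 2" for i
    using of_int_round_abs_le[of "z $ i"] by (simp add: abs_minus_commute)
  have "(norm (z - ?k))\<^sup>2 = (z $ 1 - ?k $ 1)\<^sup>2 + (z $ 2 - ?k $ 2)\<^sup>2"
    by (simp add: norm_eq_sqrt_inner inner_vec_def sum_2 power2_eq_square)
  also have "\<dots> \<le> (1 / 2)\<^sup>2 + (1 / 2)\<^sup>2"
    using le by (intro add_mono) (metis abs_le_square_iff abs_of_pos half_gt_zero zero_less_one)+
  also have "\<dots> < 1\<^sup>2" by (simp add: power2_eq_square)
  finally show "dist z ?k < 1"
    unfolding dist_norm by (rule power2_less_imp_less) simp
qed auto

lemma torus_lifts_uniformly_continuous:
  assumes F: "F \<in> torus_lifts" and e: "e > 0"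
  obtains d where "d > 0" "\<And>x y. dist x y < d \<Longrightarrow> dist (F x) (F y) < e"
proof -
  \<comment> \<open>Modulo integer translations, two points at distance below 1 may be moved into this ball, the first one into
    the unit square.\<close>
  have "uniformly_continuous_on (cball 0 3) F"
    by (intro compact_uniformly_continuous torus_lifts_continuous[OF F]) simp
  then obtain d where d: "d > 0"
    "\<And>x y. x \<in> cball 0 3 \<Longrightarrow> y \<in> cball 0 3 \<Longrightarrow> dist x y < d \<Longrightarrow> dist (F x) (F y) < e"
    using e unfolding uniformly_continuous_on_def by metis
  show thesis
  proof (rule that[of "min d 1"])
    fix x y :: "real^2" assume xy: "dist x y < min d 1"
    obtain k z where k: "\<And>i. k $ i \<in> \<int>" and z: "\<And>i. 0 \<le> z $ i" "\<And>i. z $ i < 1" and x: "x = z + k"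
      using translate_into_unit_square[of x] by metis
    have nz: "norm z \<le> 2" using norm_unit_square_le z by blast
    have d': "dist z (y - k) = dist x y" by (simp add: x dist_norm algebra_simps)
    have "norm (y - k) \<le> norm z + dist z (y - k)"
      using norm_triangle_ineq4[of z "z - (y - k)"] by (simp add: dist_norm)
    then have "dist (F z) (F (y - k)) < e"
      using d' xy nz by (intro d) auto
    moreover have "F x = F z + k" "F y = F (y - k) + k"
      using torus_lifts_add[OF F k, of z] torus_lifts_add[OF F k, of "y - k"] by (auto simp: x)
    ultimately show "dist (F x) (F y) < e" by (simp add: dist_norm)
  qed (use d in auto)
qed

definition displacement :: "(real^2 \<Rightarrow> real^2) \<Rightarrow> real^2 \<Rightarrow> real^2" where
  "displacement F x = F x - x"

lemma displacement_periodic: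
  assumes "F \<in> torus_lifts" "\<And>i. k $ i \<in> \<int>"
  shows "displacement F (x + k) = displacement F x"
  using torus_lifts_add[OF assms, of x] by (simp add: displacement_def)

lemma displacement_bounded:
  assumes F: "F \<in> torus_lifts"
  obtains M where "M > 0" "\<And>x. norm (displacement F x) \<le> M"
proof -
  have "compact (displacement F ` cball 0 2)"
    unfolding displacement_def using torus_lifts_continuous[OF F]
    by (intro compact_continuous_image continuous_intros) auto
  then obtain M where M: "M > 0" "\<And>x. x \<in> cball 0 2 \<Longrightarrow> norm (displacement F x) \<le> M"
    using compact_imp_bounded bounded_pos by (metis imageI)
  show thesis
  proof (rule that[OF M(1)])
    fix x :: "real^2"
    obtain k z where k: "\<And>i. k $ i \<in> \<int>" and z: "\<And>i. 0 \<le> z $ i" "\<And>i. z $ i < 1" and x: "x = z + k"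
      using translate_into_unit_square[of x] by metis
    have "norm z \<le> 2" using norm_unit_square_le z by blast
    then show "norm (displacement F x) \<le> M"
      using M(2)[of z] displacement_periodic[OF F k, of z] by (simp add: x)
  qed
qed

lemma displacement_funpow_bounded:
  assumes "\<And>x. norm (displacement F x) \<le> M"
  shows "norm (displacement (F ^^ n) x) \<le> real n * M"
proof (induction n)
  case (Suc n)
  have "displacement (F ^^ Suc n) x = displacement F ((F ^^ n) x) + displacement (F ^^ n) x"
    by (simp add: displacement_def)
  then have "norm (displacement (F ^^ Suc n) x) \<le> M + real n * M"
    using norm_triangle_mono[OF assms Suc] by simp
  also have "\<dots> = real (Suc n) * M"
    by (simp add: algebra_simps)
  finally show ?case .
qed (simp add: displacement_def)

text \<open>The displacements of a lift almost form a convex set, with an error that is the same for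
  all lifts. By periodicity \<open>x\<close> and \<open>y\<close> may be replaced by points \<open>a\<close> and \<open>b\<close> of the half-open
  unit square. The segment from \<open>a\<close> to \<open>b\<close> is disjoint from its nonzero integer translates, and
  so is its image under the injective map \<open>G\<close>. Hence a point of the segment from \<open>G a\<close> to \<open>G b\<close>
  is at distance below 2 from the image of some \<open>w\<close> in the square. Passing from images to
  displacements costs the norms of two points of the square, at most 2 each.\<close>

lemma segment_displacement_near:
  assumes G: "G \<in> torus_lifts"
    and v: "v \<in> closed_segment (displacement G x) (displacement G y)"
  shows "\<exists>w. dist (displacement G w) v \<le> 6"
proof -
  obtain k a where k: "\<And>i. k $ i \<in> \<int>" and a: "\<And>i. 0 \<le> a $ i" "\<And>i. a $ i < 1" and x: "x = a + k"
    using translate_into_unit_square[of x] by metis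
  obtain l b where l: "\<And>i. l $ i \<in> \<int>" and b: "\<And>i. 0 \<le> b $ i" "\<And>i. b $ i < 1" and y: "y = b + l"
    using translate_into_unit_square[of y] by metis
  define D :: "(real^2) set" where "D = {z. \<forall>i. 0 \<le> z $ i \<and> z $ i < 1}"
  have conv: "convex D"
  proof -
    have "D = (\<Inter>i. {z. axis i 1 \<bullet> z \<ge> 0} \<inter> {z. axis i 1 \<bullet> z < 1})"
      by (auto simp: D_def cart_eq_inner_axis inner_commute)
    then show ?thesis
      by (auto intro!: convex_INT convex_Int convex_halfspace_ge convex_halfspace_lt)
  qed
  have ab: "a \<in> D" "b \<in> D" using a b by (auto simp: D_def)
  have D_norm: "norm z \<le> 2" if "z \<in> D" for z
    using that norm_unit_square_le by (auto simp: D_def)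
  have D_disj: "u = 0" if "z \<in> D" "z' \<in> D" "z = u + z'" "\<And>i. u $ i \<in> \<int>" for u z z'
  proof -
    have "u $ i = 0" for i
    proof -
      have "\<bar>u $ i\<bar> < 1" using that(1-3) by (auto simp: D_def abs_if) (smt (verit))+
      then show ?thesis using that(4)[of i] Ints_nonzero_abs_less1 by blast
    qed
    then show ?thesis by (simp add: vec_eq_iff)
  qed
  obtain u where u: "0 \<le> u" "u \<le> 1" "v = (1 - u) *\<^sub>R displacement G a + u *\<^sub>R displacement G b"
    using v displacement_periodic[OF G k, of a] displacement_periodic[OF G l, of b]
    by (auto simp: closed_segment_def x y)
  define c where "c = (1 - u) *\<^sub>R a + u *\<^sub>R b"
  have c: "c \<in> D" unfolding c_def
    using u(1,2) ab by (intro convexD[OF conv]) auto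
  define \<gamma> where "\<gamma> = G \<circ> linepath a b"
  have im: "path_image \<gamma> = G ` closed_segment a b"
    by (simp add: \<gamma>_def path_image_compose)
  have seg: "closed_segment a b \<subseteq> D"
    using ab conv by (simp add: closed_segment_subset)
  have "\<exists>w\<in>path_image \<gamma>. dist w (v + c) < 2"
  proof (rule segment_near_path_disjoint_from_translates[OF _ integer_vector_near])
    show "path \<gamma>" unfolding \<gamma>_def
      by (intro path_continuous_image torus_lifts_continuous[OF G]) auto
    have "v + c = (1 - u) *\<^sub>R G a + u *\<^sub>R G b"
      by (simp add: u(3) c_def displacement_def algebra_simps)
    then show "v + c \<in> closed_segment (pathstart \<gamma>) (pathfinish \<gamma>)"
      using u(1,2) by (auto simp: \<gamma>_def pathstart_compose pathfinish_compose closed_segment_def)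
    fix m :: "real^2" assume m: "m \<in> {k. \<forall>i. k $ i \<in> \<int>}" "m \<noteq> 0"
    show "path_image \<gamma> \<inter> (+) m ` path_image \<gamma> = {}"
    proof (rule ccontr)
      assume "path_image \<gamma> \<inter> (+) m ` path_image \<gamma> \<noteq> {}"
      then obtain p q where pq: "p \<in> D" "q \<in> D" "G p = m + G q"
        unfolding im using seg by blast
      then have "G p = G (q + m)" using torus_lifts_add[OF G, of m q] m by (simp add: add.commute)
      then have "p = m + q" using torus_lifts_inj[OF G] by (simp add: inj_eq add.commute)
      then show False using D_disj[OF pq(1,2), of m] m by blast
    qed
  qed
  then obtain w where w: "w \<in> D" "dist (G w) (v + c) < 2"
    unfolding im using seg by blast
  have "displacement G w - v = (G w - (v + c)) + (c - w)" by (simp add: displacement_def)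
  then have "norm (displacement G w - v) \<le> norm (G w - (v + c)) + (norm c + norm w)"
    by (metis norm_triangle_ineq4 norm_triangle_mono order_refl)
  then have "dist (displacement G w) v \<le> 6"
    using w D_norm[OF c] D_norm[OF w(1)] by (simp add: dist_norm)
  then show ?thesis by blast
qed

text \<open>By Caratheodory's theorem a point of the hull uses at most \<open>DIM('a) + 1\<close> points of \<open>K\<close>,
  and each point after the first one costs one application of the hypothesis on segments.\<close>

lemma convex_hull_near:
  fixes K :: "'a::euclidean_space set" and C :: real
  assumes seg: "\<And>a b v. a \<in> K \<Longrightarrow> b \<in> K \<Longrightarrow> v \<in> closed_segment a b \<Longrightarrow> \<exists>w\<in>K. dist w v \<le> C"
    and C: "0 \<le> C" and v: "v \<in> convex hull K"
  shows "\<exists>w\<in>K. dist w v \<le> real DIM('a) * C"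
proof -
  have step: "\<exists>w\<in>K. dist w v \<le> real (card S - 1) * C"
    if "finite S" "S \<noteq> {}" "S \<subseteq> K" "v \<in> convex hull S" for S v
    using that
  proof (induction arbitrary: v rule: finite_ne_induct)
    case (singleton x)
    then show ?case by auto
  next
    case (insert x S)
    obtain s t b where st: "0 \<le> s" "0 \<le> t" "s + t = 1" "b \<in> convex hull S" "v = s *\<^sub>R x + t *\<^sub>R b"
      using insert.prems(2) convex_hull_insert[OF insert.hyps(2), of x] by auto
    obtain w where w: "w \<in> K" "dist w b \<le> real (card S - 1) * C"
      using insert.IH[OF _ st(4)] insert.prems(1) by auto
    have s: "s = 1 - t" using st by simp
    have "s *\<^sub>R x + t *\<^sub>R w \<in> closed_segment x w"
      using st(1,2,3) by (auto simp: closed_segment_def s)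
    then obtain w' where w': "w' \<in> K" "dist w' (s *\<^sub>R x + t *\<^sub>R w) \<le> C"
      using seg[of x w] insert.prems(1) w(1) by blast
    have "dist (s *\<^sub>R x + t *\<^sub>R w) v = t * dist w b"
      using st(2) by (simp add: st(5) dist_norm flip: scaleR_diff_right)
    also have "\<dots> \<le> dist w b" using st by (simp add: mult_left_le_one_le)
    finally have "dist w' v \<le> C + real (card S - 1) * C"
      using w w' dist_triangle[of w' v "s *\<^sub>R x + t *\<^sub>R w"] by linarith
    moreover have "card S \<ge> 1" using insert.hyps by (simp add: Suc_le_eq card_gt_0_iff)
    then have "real (card (insert x S) - 1) = 1 + real (card S - 1)"
      using insert.hyps by (simp add: of_nat_diff)
    ultimately show ?case using w'(1) by (auto simp: algebra_simps)
  qed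
  obtain S where S: "finite S" "S \<subseteq> K" "card S \<le> DIM('a) + 1" "v \<in> convex hull S"
    using v unfolding caratheodory[of K] by blast
  then have "S \<noteq> {}" by auto
  with step[OF S(1) this S(2,4)] obtain w where w: "w \<in> K" "dist w v \<le> real (card S - 1) * C" by blast
  have "real (card S - 1) * C \<le> real DIM('a) * C"
    using S(3) C by (intro mult_right_mono) auto
  then show ?thesis using w by force
qed

lemma hull_displacement_near:
  assumes G: "G \<in> torus_lifts" and v: "v \<in> convex hull (range (displacement G))"
  shows "\<exists>w. dist (displacement G w) v \<le> 12"
proof -
  have "\<exists>w\<in>range (displacement G). dist w v \<le> real DIM(real^2) * 6"
    by (rule convex_hull_near[OF _ _ v]) (use segment_displacement_near[OF G] in fastforce)+
  then show ?thesis by auto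
qed

text \<open>Every \<open>F ^^ n\<close> is a lift, so the constant 12 bounds the defect of convexity of its
  displacements for all \<open>n\<close>, and division by \<open>n\<close> makes this defect disappear. The criterion
  makes convexity available for rotation sets: conversely, every rotation vector satisfies the
  hypothesis.\<close>

lemma mem_rotation_setI:
  assumes F: "F \<in> torus_lifts"
    and v: "\<And>n. n \<ge> 1 \<Longrightarrow> real n *\<^sub>R v \<in> closure (convex hull (range (displacement (F ^^ n))))"
  shows "v \<in> rotation_set F"
proof -
  have "\<exists>x. dist (displacement (F ^^ Suc n) x) (real (Suc n) *\<^sub>R v) \<le> 13" for n
  proof -
    obtain u where u: "u \<in> convex hull (range (displacement (F ^^ Suc n)))" "dist u (real (Suc n) *\<^sub>R v) < 1"
      using v[of "Suc n"] unfolding closure_approachable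
      by (metis dist_commute le_add1 plus_1_eq_Suc zero_less_one)
    obtain x where "dist (displacement (F ^^ Suc n) x) u \<le> 12"
      using hull_displacement_near[OF torus_lifts_funpow[OF F] u(1)] by blast
    then show ?thesis
      using u(2) dist_triangle[of "displacement (F ^^ Suc n) x" "real (Suc n) *\<^sub>R v" u] by (intro exI[of _ x]) linarith
  qed
  then obtain x where x: "\<And>n. dist (displacement (F ^^ Suc n) (x n)) (real (Suc n) *\<^sub>R v) \<le> 13" by metis
  have "(\<lambda>i. ((F ^^ Suc i) (x i) - x i) /\<^sub>R real (Suc i)) \<longlonglongrightarrow> v"
  proof (rule metric_LIMSEQ_I)
    fix r :: real assume r: "r > 0"
    obtain N where N: "13 / r < real N" using reals_Archimedean2 by blast
    show "\<exists>N. \<forall>i\<ge>N. dist (((F ^^ Suc i) (x i) - x i) /\<^sub>R real (Suc i)) v < r"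
    proof (intro exI allI impI)
      fix i assume "i \<ge> N"
      have "((F ^^ Suc i) (x i) - x i) /\<^sub>R real (Suc i) - v
        = (displacement (F ^^ Suc i) (x i) - real (Suc i) *\<^sub>R v) /\<^sub>R real (Suc i)"
        unfolding displacement_def scaleR_diff_right[of "inverse (real (Suc i))" "_ - _"] by simp
      then have "dist (((F ^^ Suc i) (x i) - x i) /\<^sub>R real (Suc i)) v
        = dist (displacement (F ^^ Suc i) (x i)) (real (Suc i) *\<^sub>R v) / real (Suc i)"
        unfolding dist_norm by (simp only: norm_scaleR divide_inverse mult.commute abs_inverse abs_of_nat)
      also have "\<dots> \<le> 13 / real (Suc i)"
        using x[of i] by (intro divide_right_mono) auto
      also have "\<dots> < r"
      proof -
        have "13 / r < real (Suc i)" using N \<open>i \<ge> N\<close> by linarith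
        then show ?thesis using r by (simp add: field_simps del: of_nat_Suc)
      qed
      finally show "dist (((F ^^ Suc i) (x i) - x i) /\<^sub>R real (Suc i)) v < r" .
    qed
  qed
  moreover have "filterlim Suc at_top sequentially" by (rule filterlim_Suc)
  moreover have "mono Suc" by (simp add: mono_def)
  ultimately show ?thesis unfolding rotation_set_def by blast
qed

section \<open>Pseudo-orbits\<close>

lemma pseudo_orbit_segment:
  assumes "pseudo_orbit \<epsilon> F N \<xi>" "a + m \<le> N"
  shows "pseudo_orbit \<epsilon> F m (\<lambda>j. \<xi> (a + j))"
  using assms by (auto simp: pseudo_orbit_def)

lemma pseudo_orbit_shadowed:
  assumes F: "F \<in> torus_lifts"
  shows "d > 0 \<Longrightarrow> \<exists>e>0. \<forall>\<epsilon>\<le>e. \<forall>\<xi>. pseudo_orbit \<epsilon> F m \<xi> \<longrightarrow> dist (\<xi> m) ((F ^^ m) (\<xi> 0)) \<le> d"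
proof (induction m arbitrary: d)
  case 0
  then show ?case by (auto intro!: exI[of _ 1])
next
  case (Suc m)
  obtain c where c: "c > 0" "\<And>x y. dist x y < c \<Longrightarrow> dist (F x) (F y) < d / 2"
    using torus_lifts_uniformly_continuous[OF F, of "d / 2"] Suc.prems by auto
  obtain e where e: "e > 0"
    "\<And>\<epsilon> \<xi>. \<epsilon> \<le> e \<Longrightarrow> pseudo_orbit \<epsilon> F m \<xi> \<Longrightarrow> dist (\<xi> m) ((F ^^ m) (\<xi> 0)) \<le> c / 2"
    using Suc.IH[of "c / 2"] c(1) by auto
  show ?case
  proof (intro exI[of _ "min e (d / 2)"] conjI allI impI)
    fix \<epsilon> \<xi> assume \<epsilon>: "\<epsilon> \<le> min e (d / 2)" and po: "pseudo_orbit \<epsilon> F (Suc m) \<xi>"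
    have "dist (\<xi> m) ((F ^^ m) (\<xi> 0)) < c"
      using e(2)[of \<epsilon> \<xi>] \<epsilon> po c(1) by (force simp: pseudo_orbit_def)
    then have "dist (F (\<xi> m)) ((F ^^ Suc m) (\<xi> 0)) < d / 2"
      using c(2) by simp
    moreover have "dist (\<xi> (Suc m)) (F (\<xi> m)) \<le> d / 2"
    proof -
      have "norm (F (\<xi> m) - \<xi> (Suc m)) \<le> \<epsilon>"
        using po by (simp add: pseudo_orbit_def)
      then show ?thesis using \<epsilon> by (simp add: dist_norm norm_minus_commute)
    qed
    ultimately show "dist (\<xi> (Suc m)) ((F ^^ Suc m) (\<xi> 0)) \<le> d"
      using dist_triangle[of "\<xi> (Suc m)" "(F ^^ Suc m) (\<xi> 0)" "F (\<xi> m)"] by linarith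
  qed (use e Suc.prems in auto)
qed

lemma pseudo_orbit_drift:
  assumes M: "\<And>x. norm (displacement F x) \<le> M" and po: "pseudo_orbit \<epsilon> F n \<xi>"
  shows "norm (\<xi> n - \<xi> 0) \<le> real n * (M + \<epsilon>)"
  using po
proof (induction n)
  case (Suc n)
  have "norm (F (\<xi> n) - \<xi> (Suc n)) \<le> \<epsilon>"
    using Suc.prems by (simp add: pseudo_orbit_def)
  moreover have "\<xi> (Suc n) - \<xi> 0 = (\<xi> n - \<xi> 0) + (displacement F (\<xi> n) - (F (\<xi> n) - \<xi> (Suc n)))"
    by (simp add: displacement_def)
  moreover have "norm (displacement F (\<xi> n) - (F (\<xi> n) - \<xi> (Suc n))) \<le> M + \<epsilon>"
    using M[of "\<xi> n"] calculation(1) norm_triangle_ineq4[of "displacement F (\<xi> n)" "F (\<xi> n) - \<xi> (Suc n)"]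
    by linarith
  ultimately have "norm (\<xi> (Suc n) - \<xi> 0) \<le> norm (\<xi> n - \<xi> 0) + (M + \<epsilon>)"
    by (metis norm_triangle_mono order_refl)
  moreover have "norm (\<xi> n - \<xi> 0) \<le> real n * (M + \<epsilon>)"
    using Suc by (simp add: pseudo_orbit_def)
  ultimately show ?case by (simp add: algebra_simps)
qed simp

text \<open>Cut the pseudo-orbit into \<open>q\<close> blocks of length \<open>m\<close> and a remainder of length \<open>r < m\<close>. Each
  block moves by a displacement of \<open>F ^^ m\<close>, up to the shadowing error \<open>d\<close>; the average \<open>u\<close> of
  these displacements is in the hull. The remainder, and the replacement of \<open>q * m\<close> by \<open>N\<close> in
  the denominator, contribute the term of order \<open>1 / N\<close>.\<close>

lemma pseudo_orbit_average_near_hull: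
  assumes M: "\<And>x. norm (displacement F x) \<le> M"
    and shadow: "\<And>\<eta>. pseudo_orbit \<epsilon> F m \<eta> \<Longrightarrow> dist (\<eta> m) ((F ^^ m) (\<eta> 0)) \<le> d"
    and \<epsilon>: "\<epsilon> \<le> 1" and d: "0 \<le> d" and m: "1 \<le> m" "m \<le> N" and po: "pseudo_orbit \<epsilon> F N \<xi>"
  shows "\<exists>u\<in>convex hull (range (displacement (F ^^ m))).
    norm (real m *\<^sub>R ((\<xi> N - \<xi> 0) /\<^sub>R real N) - u) \<le> d + (real m)\<^sup>2 * (2 * M + 1) / real N"
proof -
  have M0: "0 \<le> M" using M[of 0] norm_ge_zero order_trans by blast
  define q r where "q = N div m" and "r = N mod m"
  have N: "N = q * m + r" "r < m" "0 < q" "0 < N"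
    using m by (auto simp: q_def r_def div_greater_zero_iff)
  define u where "u = (\<Sum>s<q. (1 / real q) *\<^sub>R displacement (F ^^ m) (\<xi> (s * m)))"
  have u: "u \<in> convex hull (range (displacement (F ^^ m)))"
    unfolding u_def using N(3)
    by (intro convex_sum) (auto intro!: hull_inc)
  have "convex hull (range (displacement (F ^^ m))) \<subseteq> cball 0 (real m * M)"
    by (rule hull_minimal) (auto simp: displacement_funpow_bounded[OF M])
  then have norm_u: "norm u \<le> real m * M" using u by auto
  \<comment> \<open>\<open>E\<close> collects the shadowing errors of the blocks and the movement during the remainder.\<close>
  define E where "E = \<xi> N - \<xi> 0 - real q *\<^sub>R u"
  have qu: "real q *\<^sub>R u = (\<Sum>s<q. displacement (F ^^ m) (\<xi> (s * m)))"
    using N(3) by (simp add: u_def scaleR_sum_right)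
  have tele: "(\<Sum>s<q. \<xi> (Suc s * m) - \<xi> (s * m)) = \<xi> (q * m) - \<xi> 0"
    using sum_lessThan_telescope[of "\<lambda>s. \<xi> (s * m)" q] by simp
  have block: "norm (\<xi> (Suc s * m) - \<xi> (s * m) - displacement (F ^^ m) (\<xi> (s * m))) \<le> d" if "s < q" for s
  proof -
    have "Suc s * m \<le> q * m" using that by (intro mult_le_mono) auto
    then have "s * m + m \<le> N" using N(1) by simp
    from shadow[OF pseudo_orbit_segment[OF po this]] show ?thesis
      by (simp add: dist_norm displacement_def algebra_simps)
  qed
  have "E = (\<Sum>s<q. \<xi> (Suc s * m) - \<xi> (s * m) - displacement (F ^^ m) (\<xi> (s * m))) + (\<xi> N - \<xi> (q * m))"
    by (simp only: E_def qu sum_subtractf[of _ "\<lambda>s. displacement (F ^^ m) (\<xi> (s * m))"] tele) simp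
  also have "norm \<dots> \<le> real q * d + real r * (M + 1)"
  proof (rule norm_triangle_mono)
    show "norm (\<Sum>s<q. \<xi> (Suc s * m) - \<xi> (s * m) - displacement (F ^^ m) (\<xi> (s * m))) \<le> real q * d"
      using sum_norm_le[of "{..<q}" "\<lambda>s. \<xi> (Suc s * m) - \<xi> (s * m) - displacement (F ^^ m) (\<xi> (s * m))" "\<lambda>_. d"] block
      by simp
    have "norm (\<xi> N - \<xi> (q * m)) \<le> real r * (M + \<epsilon>)"
      using pseudo_orbit_drift[OF M pseudo_orbit_segment[OF po, of "q * m" r]] N(1) by simp
    also have "\<dots> \<le> real r * (M + 1)" using \<epsilon> by (intro mult_left_mono) auto
    finally show "norm (\<xi> N - \<xi> (q * m)) \<le> real r * (M + 1)" .
  qed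
  finally have E: "norm E \<le> real q * d + real r * (M + 1)" .
  have cancel: "real N * (real m * inverse (real N)) = real m"
    using N(4) by simp
  have "real N *\<^sub>R (real m *\<^sub>R ((\<xi> N - \<xi> 0) /\<^sub>R real N) - u) = real m *\<^sub>R (\<xi> N - \<xi> 0) - real N *\<^sub>R u"
    by (simp only: scaleR_diff_right[of "real N" _ u] scaleR_scaleR cancel)
  also have "\<dots> = real m *\<^sub>R E - real r *\<^sub>R u"
    by (simp add: E_def N(1) algebra_simps)
  finally have "real N * norm (real m *\<^sub>R ((\<xi> N - \<xi> 0) /\<^sub>R real N) - u) = norm (real m *\<^sub>R E - real r *\<^sub>R u)"
    by (metis abs_of_nat norm_scaleR)
  also have "\<dots> \<le> real m * norm E + real r * norm u"
    using norm_triangle_ineq4[of "real m *\<^sub>R E" "real r *\<^sub>R u"] by simp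
  also have "\<dots> \<le> real m * (real q * d + real r * (M + 1)) + real r * (real m * M)"
    using E norm_u by (intro add_mono mult_left_mono) auto
  also have "\<dots> = real (q * m) * d + real r * (real m * (2 * M + 1))"
    by (simp add: algebra_simps)
  also have "\<dots> \<le> real N * d + real m * (real m * (2 * M + 1))"
    using N d M0 by (intro add_mono mult_right_mono) auto
  also have "\<dots> = real N * (d + (real m)\<^sup>2 * (2 * M + 1) / real N)"
    using N(4) by (simp add: field_simps power2_eq_square)
  finally have "norm (real m *\<^sub>R ((\<xi> N - \<xi> 0) /\<^sub>R real N) - u) \<le> d + (real m)\<^sup>2 * (2 * M + 1) / real N"
    using N(4) by (simp only: mult_le_cancel_left_pos of_nat_0_less_iff)
  then show ?thesis using u by blast
qed

lemma eps_rotation_set_near_hull: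
  assumes F: "F \<in> torus_lifts" and m: "1 \<le> m" and d: "d > 0"
  shows "\<exists>e>0. \<forall>\<epsilon>\<le>e. \<forall>v\<in>eps_rotation_set \<epsilon> F.
    \<exists>u\<in>convex hull (range (displacement (F ^^ m))). dist u (real m *\<^sub>R v) < d"
proof -
  obtain M where M: "\<And>x. norm (displacement F x) \<le> M"
    using displacement_bounded[OF F] by blast
  obtain e where e: "e > 0"
    "\<And>\<epsilon> \<xi>. \<epsilon> \<le> e \<Longrightarrow> pseudo_orbit \<epsilon> F m \<xi> \<Longrightarrow> dist (\<xi> m) ((F ^^ m) (\<xi> 0)) \<le> d / 3"
    using pseudo_orbit_shadowed[OF F, of "d / 3" m] d by auto
  show ?thesis
  proof (intro exI[of _ "min e 1"] conjI allI impI ballI)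
    fix \<epsilon> v assume \<epsilon>: "\<epsilon> \<le> min e 1" and "v \<in> eps_rotation_set \<epsilon> F"
    then obtain n \<xi> r where n: "filterlim n at_top sequentially" and po: "\<And>i. pseudo_orbit \<epsilon> F (n i) (\<xi> i)"
      and r: "strict_mono r" and lim: "((\<lambda>i. (\<xi> i (n i) - \<xi> i 0) /\<^sub>R real (n i)) \<circ> r) \<longlonglongrightarrow> v"
      unfolding eps_rotation_set_def accumulation_points_def by blast
    define N where "N = n \<circ> r"
    define X where "X i = (\<xi> (r i) (N i) - \<xi> (r i) 0) /\<^sub>R real (N i)" for i
    have N: "filterlim N at_top sequentially"
      unfolding N_def comp_def using n filterlim_subseq[OF r] by (rule filterlim_compose)
    have X: "(\<lambda>i. real m *\<^sub>R X i) \<longlonglongrightarrow> real m *\<^sub>R v"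
      using lim by (intro tendsto_intros) (simp add: X_def N_def comp_def)
    have "(\<lambda>i. (real m)\<^sup>2 * (2 * M + 1) / real (N i)) \<longlonglongrightarrow> 0"
      by (intro tendsto_divide_0[OF tendsto_const] filterlim_at_top_imp_at_infinity
          filterlim_compose[OF filterlim_real_sequentially N])
    then have "\<forall>\<^sub>F i in sequentially. (real m)\<^sup>2 * (2 * M + 1) / real (N i) < d / 3"
      using d by (intro order_tendstoD(2)) auto
    moreover have "\<forall>\<^sub>F i in sequentially. dist (real m *\<^sub>R X i) (real m *\<^sub>R v) < d / 3"
      using X d by (intro tendstoD) auto
    moreover have "\<forall>\<^sub>F i in sequentially. m \<le> N i"
      using N by (auto simp: filterlim_at_top)
    ultimately have "\<forall>\<^sub>F i in sequentially. (real m)\<^sup>2 * (2 * M + 1) / real (N i) < d / 3 \<and>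
        dist (real m *\<^sub>R X i) (real m *\<^sub>R v) < d / 3 \<and> m \<le> N i"
      by eventually_elim blast
    then obtain i where i: "(real m)\<^sup>2 * (2 * M + 1) / real (N i) < d / 3"
      "dist (real m *\<^sub>R X i) (real m *\<^sub>R v) < d / 3" "m \<le> N i"
      using eventually_happens'[OF sequentially_bot] by blast
    have "pseudo_orbit \<epsilon> F (N i) (\<xi> (r i))" using po by (simp add: N_def)
    then obtain u where u: "u \<in> convex hull (range (displacement (F ^^ m)))"
      "norm (real m *\<^sub>R X i - u) \<le> d / 3 + (real m)\<^sup>2 * (2 * M + 1) / real (N i)"
      unfolding X_def
      using pseudo_orbit_average_near_hull[OF M e(2)[of \<epsilon>] _ _ m i(3)] \<epsilon> d by auto
    have "dist u (real m *\<^sub>R X i) < d / 3 + d / 3"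
      using u(2) i(1) unfolding dist_norm norm_minus_commute[of u] by linarith
    then have "dist u (real m *\<^sub>R v) < d"
      using i(2) dist_triangle[of u "real m *\<^sub>R v" "real m *\<^sub>R X i"] by linarith
    then show "\<exists>u\<in>convex hull (range (displacement (F ^^ m))). dist u (real m *\<^sub>R v) < d"
      using u(1) by blast
  qed (use e in auto)
qed

text \<open>The size of \<open>\<epsilon>\<close> in the previous lemma depends on \<open>m\<close>; compactness removes this dependence.
  Vectors \<open>v i\<close> violating the claim for \<open>\<epsilon> i\<close> tending to 0 would be bounded, and a limit \<open>l\<close> of
  a subsequence would satisfy the criterion for rotation vectors for every \<open>n\<close>, although the
  \<open>v i\<close> keep the distance \<open>d\<close> from all rotation vectors.\<close>

lemma eps_rotation_set_near_rotation_set: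
  assumes F: "F \<in> torus_lifts" and d: "d > 0"
  shows "\<exists>e>0. \<forall>\<epsilon>\<le>e. \<forall>v\<in>eps_rotation_set \<epsilon> F. \<exists>u\<in>rotation_set F. dist v u \<le> d"
proof (rule ccontr)
  assume contra: "\<not> ?thesis"
  obtain M where M: "\<And>x. norm (displacement F x) \<le> M"
    using displacement_bounded[OF F] by blast
  obtain e1 where e1: "e1 > 0" "\<And>\<epsilon> v. \<epsilon> \<le> e1 \<Longrightarrow> v \<in> eps_rotation_set \<epsilon> F \<Longrightarrow>
      \<exists>u\<in>convex hull (range (displacement F)). dist u v < 1"
    using eps_rotation_set_near_hull[OF F, of 1 1] by auto
  have "\<exists>\<epsilon> v. \<epsilon> \<le> min e1 (inverse (real (Suc i))) \<and> v \<in> eps_rotation_set \<epsilon> F \<and>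
      (\<forall>u\<in>rotation_set F. d < dist v u)" for i
  proof -
    have "min e1 (inverse (real (Suc i))) > 0" using e1(1) by simp
    then show ?thesis using contra by (meson not_le)
  qed
  then obtain \<epsilon> v where v: "\<And>i. \<epsilon> i \<le> min e1 (inverse (real (Suc i)))"
    "\<And>i. v i \<in> eps_rotation_set (\<epsilon> i) F" "\<And>i u. u \<in> rotation_set F \<Longrightarrow> d < dist (v i) u"
    by metis
  have "v i \<in> cball 0 (M + 1)" for i
  proof -
    obtain u where u: "u \<in> convex hull (range (displacement F))" "dist u (v i) < 1"
      using e1(2)[of "\<epsilon> i" "v i"] v(1,2)[of i] by auto
    have "convex hull (range (displacement F)) \<subseteq> cball 0 M"
      by (rule hull_minimal) (auto simp: M)
    then have "norm u \<le> M" using u(1) by auto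
    then show ?thesis
      using u(2) norm_triangle_sub[of "v i" u] by (simp add: dist_norm norm_minus_commute)
  qed
  then obtain l r where r: "strict_mono (r :: nat \<Rightarrow> nat)" and l: "(v \<circ> r) \<longlonglongrightarrow> l"
    using compact_cball[of 0 "M + 1"] unfolding compact_def by metis
  have "l \<in> rotation_set F"
  proof (rule mem_rotation_setI[OF F])
    fix n :: nat assume n: "n \<ge> 1"
    show "real n *\<^sub>R l \<in> closure (convex hull (range (displacement (F ^^ n))))"
      unfolding closure_approachable
    proof (intro allI impI)
      fix c :: real assume c: "c > 0"
      obtain e where e: "e > 0" "\<And>\<epsilon> v. \<epsilon> \<le> e \<Longrightarrow> v \<in> eps_rotation_set \<epsilon> F \<Longrightarrow>
          \<exists>u\<in>convex hull (range (displacement (F ^^ n))). dist u (real n *\<^sub>R v) < c / 2"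
        using eps_rotation_set_near_hull[OF F n, of "c / 2"] c by auto
      have "(\<lambda>i. real n *\<^sub>R (v \<circ> r) i) \<longlonglongrightarrow> real n *\<^sub>R l"
        by (intro tendsto_intros l)
      then have "\<forall>\<^sub>F i in sequentially. dist (real n *\<^sub>R (v \<circ> r) i) (real n *\<^sub>R l) < c / 2"
        using c by (intro tendstoD) auto
      moreover have "\<forall>\<^sub>F i in sequentially. inverse (real (Suc (r i))) < e"
        using LIMSEQ_subseq_LIMSEQ[OF LIMSEQ_inverse_real_of_nat r] e(1)
        by (intro order_tendstoD(2)) (auto simp: comp_def)
      ultimately have "\<forall>\<^sub>F i in sequentially. dist (real n *\<^sub>R (v \<circ> r) i) (real n *\<^sub>R l) < c / 2 \<and>
          inverse (real (Suc (r i))) < e"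
        by eventually_elim blast
      then obtain i where i: "dist (real n *\<^sub>R v (r i)) (real n *\<^sub>R l) < c / 2" "inverse (real (Suc (r i))) < e"
        using eventually_happens'[OF sequentially_bot] unfolding comp_def by blast
      obtain u where u: "u \<in> convex hull (range (displacement (F ^^ n)))" "dist u (real n *\<^sub>R v (r i)) < c / 2"
        using e(2)[of "\<epsilon> (r i)" "v (r i)"] v(1,2)[of "r i"] i(2) by auto
      then show "\<exists>u\<in>convex hull (range (displacement (F ^^ n))). dist u (real n *\<^sub>R l) < c"
        using i(1) dist_triangle_half_r[of "real n *\<^sub>R v (r i)" u c "real n *\<^sub>R l"]
        by (metis dist_commute)
    qed
  qed
  then have "\<forall>i. d < dist ((v \<circ> r) i) l" using v(3) by simp
  moreover have "\<forall>\<^sub>F i in sequentially. dist ((v \<circ> r) i) l < d" using l d by (rule tendstoD)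
  ultimately show False
    using eventually_happens'[OF sequentially_bot] by (metis (mono_tags, lifting) less_asym)
qed

section \<open>Convergence of the rotation sets\<close>

lemma rotation_set_subset_eps:
  assumes "0 \<le> \<epsilon>"
  shows "rotation_set F \<subseteq> eps_rotation_set \<epsilon> F"
proof
  fix v assume "v \<in> rotation_set F"
  then obtain n x where n: "filterlim n at_top sequentially"
    and lim: "(\<lambda>i. ((F ^^ n i) (x i) - x i) /\<^sub>R real (n i)) \<longlonglongrightarrow> v"
    unfolding rotation_set_def by blast
  define \<xi> where "\<xi> i j = (F ^^ j) (x i)" for i j
  have "pseudo_orbit \<epsilon> F (n i) (\<xi> i)" for i
    using assms by (simp add: pseudo_orbit_def \<xi>_def)
  moreover have "v \<in> accumulation_points (\<lambda>i. (\<xi> i (n i) - \<xi> i 0) /\<^sub>R real (n i))"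
    unfolding accumulation_points_def using lim
    by (auto simp: \<xi>_def comp_def intro!: exI[of _ id] strict_monoI)
  ultimately show "v \<in> eps_rotation_set \<epsilon> F"
    unfolding eps_rotation_set_def using n by blast
qed

lemma hausdorff_distance_superset_le:
  assumes "B \<subseteq> A" "\<And>a. a \<in> A \<Longrightarrow> \<exists>b\<in>B. dist a b \<le> d"
  shows "hausdorff_distance A B \<le> ennreal d"
proof -
  have "(SUP a\<in>A. INF b\<in>B. ennreal (dist a b)) \<le> ennreal d"
    by (rule SUP_least) (use assms(2) in \<open>blast intro: INF_lower2 ennreal_leI\<close>)
  moreover have "(SUP b\<in>B. INF a\<in>A. ennreal (dist a b)) \<le> ennreal d"
  proof (rule SUP_least)
    fix b assume "b \<in> B"
    then have "(INF a\<in>A. ennreal (dist a b)) \<le> ennreal (dist b b)"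
      using assms(1) by (intro INF_lower) auto
    then show "(INF a\<in>A. ennreal (dist a b)) \<le> ennreal d" by simp
  qed
  ultimately show ?thesis by (simp add: hausdorff_distance_def)
qed

theorem theorem7:
  fixes F :: "real^2 \<Rightarrow> real^2"
  assumes "F \<in> torus_lifts"
  shows "((\<lambda>\<epsilon>. hausdorff_distance (eps_rotation_set \<epsilon> F) (rotation_set F)) \<longlongrightarrow> 0) (at_right 0)"
proof (rule order_tendstoI)
  fix a :: ennreal assume "0 < a"
  then obtain b where b: "0 < b" "b < a" using dense by blast
  then obtain d where d: "b = ennreal d" "d > 0"
    by (cases b) (auto simp: top_unique)
  obtain e where e: "e > 0"
    "\<And>\<epsilon> v. \<epsilon> \<le> e \<Longrightarrow> v \<in> eps_rotation_set \<epsilon> F \<Longrightarrow> \<exists>u\<in>rotation_set F. dist v u \<le> d"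
    using eps_rotation_set_near_rotation_set[OF assms d(2)] by blast
  have "hausdorff_distance (eps_rotation_set \<epsilon> F) (rotation_set F) < a" if "0 < \<epsilon>" "\<epsilon> < e" for \<epsilon>
  proof -
    have "hausdorff_distance (eps_rotation_set \<epsilon> F) (rotation_set F) \<le> ennreal d"
    proof (rule hausdorff_distance_superset_le[OF rotation_set_subset_eps])
      show "\<exists>u\<in>rotation_set F. dist v u \<le> d" if "v \<in> eps_rotation_set \<epsilon> F" for v
        using e(2)[OF _ that] \<open>\<epsilon> < e\<close> by simp
    qed (use that in simp)
    then show ?thesis using b(2) d(1) by simp
  qed
  then show "\<forall>\<^sub>F \<epsilon> in at_right 0. hausdorff_distance (eps_rotation_set \<epsilon> F) (rotation_set F) < a"
    using e(1) unfolding eventually_at_right_field by blast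
qed auto

end
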